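(* For $n=6$ the bisymmetric nonnegative inverse eigenvalue problem and the symmetric nonnegative inverse eigenvalue problem are different; that is, there exists a list of six real numbers which is the spectrum (with multiplicity) of a $6\times 6$ symmetric nonnegative matrix but is not the spectrum of any $6\times 6$ bisymmetric nonnegative matrix.
   Context: All matrices are real. A square matrix $Q$ is bisymmetric if $Q^T=Q$ and $JQJ=Q$, where $J$ is the reverse identity matrix (ones on the anti-diagonal, zeros elsewhere). A matrix is nonnegative if all its entries are $\ge 0$. The symmetric (respectively bisymmetric) nonnegative inverse eigenvalue problem, SNIEP (respectively BNIEP), asks which lists of $n$ numbers are spectra of $n\times n$ symmetric (respectively bisymmetric) nonnegative matrices. *)

theory Defs
  imports "Jordan_Normal_Form.Char_Poly"
begin

definition reverse_identity_mat :: "nat \<Rightarrow> real mat" where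
  "reverse_identity_mat n = mat n n (\<lambda>(i, j). if i + j + 1 = n then 1 else 0)"

definition symmetric_mat :: "real mat \<Rightarrow> bool" where
  "symmetric_mat Q \<longleftrightarrow> square_mat Q \<and> transpose_mat Q = Q"

definition bisymmetric_mat :: "real mat \<Rightarrow> bool" where
  "bisymmetric_mat Q \<longleftrightarrow> symmetric_mat Q \<and>
     reverse_identity_mat (dim_row Q) * Q * reverse_identity_mat (dim_row Q) = Q"

definition nonneg_mat :: "real mat \<Rightarrow> bool" where
  "nonneg_mat Q \<longleftrightarrow> 0\<^sub>m (dim_row Q) (dim_col Q) \<le> Q"

text \<open>
  The list enumerates all eigenvalues, in any order, each repeated according to its algebraic
  multiplicity. In particular the characteristic polynomial splits over the reals.
\<close>

definition has_spectrum_list :: "real mat \<Rightarrow> real list \<Rightarrow> bool" where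
  "has_spectrum_list Q xs \<longleftrightarrow> char_poly Q = (\<Prod>x\<leftarrow>xs. [:- x, 1:])"

text \<open>
  The solution sets of the two inverse eigenvalue problems. Real lists suffice, since real
  symmetric matrices have only real eigenvalues.
\<close>

definition SNIEP :: "nat \<Rightarrow> real list set" where
  "SNIEP n = {xs. length xs = n \<and>
     (\<exists>Q\<in>carrier_mat n n. symmetric_mat Q \<and> nonneg_mat Q \<and> has_spectrum_list Q xs)}"

definition BNIEP :: "nat \<Rightarrow> real list set" where
  "BNIEP n = {xs. length xs = n \<and>
     (\<exists>Q\<in>carrier_mat n n. bisymmetric_mat Q \<and> nonneg_mat Q \<and> has_spectrum_list Q xs)}"

end

(*
  A bisymmetric matrix of size 6 is orthogonally similar to diag(A + G, A - G) with A, G symmetric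
  nonnegative of size 3, so its spectrum splits into the spectra of S = A + G and D = A - G, where
  |D| <= S entrywise. The list 8, -1, -7, 8, -4, -4 is the spectrum of a direct sum of two
  symmetric nonnegative blocks with spectra (8, -1, -7) and (8, -4, -4). Its sum is 0, so in a
  bisymmetric realization A has zero diagonal and diag S = - diag D >= 0. If S and D share the two
  eigenvalues 8, comparing second and third elementary symmetric functions contradicts |D| <= S.
  If S has both, then 8 I - S has rank one, which isolates an index of S with diagonal entry 8;
  then -8 would be an eigenvalue of D.
*)

theory Submission
  imports Defs
begin

section \<open>Characteristic polynomials\<close>

lemma det_3:
  fixes A :: "'a :: comm_ring_1 mat"
  assumes "A \<in> carrier_mat 3 3"
  shows "det A =
      A $$ (0,0) * (A $$ (1,1) * A $$ (2,2) - A $$ (1,2) * A $$ (2,1))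
    - A $$ (0,1) * (A $$ (1,0) * A $$ (2,2) - A $$ (1,2) * A $$ (2,0))
    + A $$ (0,2) * (A $$ (1,0) * A $$ (2,1) - A $$ (1,1) * A $$ (2,0))"
proof -
  have det_2: "det B = B $$ (0,0) * B $$ (1,1) - B $$ (0,1) * B $$ (1,0)"
    if "B \<in> carrier_mat 2 2" for B :: "'a mat"
    using that
    by (simp add: laplace_expansion_row[of B 2 0] cofactor_def det_single lessThan_Suc
        numeral_2_eq_2 mat_delete_def)
  show ?thesis
    using assms
    by (simp add: laplace_expansion_row[of A 3 0] cofactor_def det_2 lessThan_Suc
        eval_nat_numeral mat_delete_def algebra_simps)
qed

text \<open>The coefficients show the elementary symmetric functions of the eigenvalues. Each
  off-diagonal entry is named after the index it avoids, so permuting indices permutes the pairs (a,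
  x), (b, y), (c, z).\<close>

lemma char_poly_symmetric_3:
  fixes A :: "'a :: comm_ring_1 mat"
  assumes A: "A \<in> carrier_mat 3 3"
    and sym: "A $$ (1,0) = A $$ (0,1)" "A $$ (2,0) = A $$ (0,2)" "A $$ (2,1) = A $$ (1,2)"
  defines "a \<equiv> A $$ (0,0)" and "b \<equiv> A $$ (1,1)" and "c \<equiv> A $$ (2,2)"
    and "x \<equiv> A $$ (1,2)" and "y \<equiv> A $$ (0,2)" and "z \<equiv> A $$ (0,1)"
  shows "char_poly A =
    [:- (a * b * c + 2 * x * y * z - a * x^2 - b * y^2 - c * z^2),
      a * b + a * c + b * c - x^2 - y^2 - z^2, - (a + b + c), 1:]"
proof -
  have "char_poly_matrix A \<in> carrier_mat 3 3" using A by simp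
  from det_3[OF this] show ?thesis
    using A sym unfolding char_poly_defs
    by (simp add: a_def b_def c_def x_def y_def z_def algebra_simps power2_eq_square numeral_2_eq_2)
qed

lemma char_poly_block_diag:
  fixes A B :: "'a :: idom mat"
  assumes A: "A \<in> carrier_mat n n" and B: "B \<in> carrier_mat m m"
  shows "char_poly (four_block_mat A (0\<^sub>m n m) (0\<^sub>m m n) B) = char_poly A * char_poly B"
proof -
  have "char_poly_matrix (four_block_mat A (0\<^sub>m n m) (0\<^sub>m m n) B)
      = four_block_mat (char_poly_matrix A) (0\<^sub>m n m) (0\<^sub>m m n) (char_poly_matrix B)"
    using A B by (intro eq_matI) (auto simp: char_poly_matrix_def one_poly_def)
  then show ?thesis
    using A B unfolding char_poly_def
    by (simp add: det_four_block_mat_upper_right_zero[of _ n _ m])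
qed

section \<open>The reverse identity and centrosymmetric matrices\<close>

lemma reverse_identity_carrier [simp]: "reverse_identity_mat n \<in> carrier_mat n n"
  by (simp add: reverse_identity_mat_def)

lemma reverse_identity_mult_index:
  assumes A: "A \<in> carrier_mat n m" and i: "i < n" and j: "j < m"
  shows "(reverse_identity_mat n * A) $$ (i, j) = A $$ (n - 1 - i, j)"
proof -
  have eq: "i + k + 1 = n \<longleftrightarrow> k = n - Suc i" for k using i by auto
  have "(reverse_identity_mat n * A) $$ (i, j) = (\<Sum>k<n. if k = n - Suc i then A $$ (k, j) else 0)"
    using A i j eq
    by (auto simp: reverse_identity_mat_def scalar_prod_def atLeast0LessThan
        simp del: sum.delta sum.delta' intro!: sum.cong)
  then show ?thesis using i by simp
qed

lemma mult_reverse_identity_index: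
  assumes A: "A \<in> carrier_mat m n" and i: "i < m" and j: "j < n"
  shows "(A * reverse_identity_mat n) $$ (i, j) = A $$ (i, n - 1 - j)"
proof -
  have eq: "k + j + 1 = n \<longleftrightarrow> k = n - Suc j" for k using j by auto
  have "(A * reverse_identity_mat n) $$ (i, j) = (\<Sum>k<n. if k = n - Suc j then A $$ (i, k) else 0)"
    using A i j eq
    by (auto simp: reverse_identity_mat_def scalar_prod_def atLeast0LessThan
        simp del: sum.delta sum.delta' intro!: sum.cong)
  then show ?thesis using j by simp
qed

lemma reverse_identity_squared: "reverse_identity_mat n * reverse_identity_mat n = 1\<^sub>m n"
proof (rule eq_matI)
  fix i j assume "i < dim_row (1\<^sub>m n :: real mat)" "j < dim_col (1\<^sub>m n :: real mat)"
  then have "i < n" "j < n" by simp_all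
  then show "(reverse_identity_mat n * reverse_identity_mat n) $$ (i, j) = 1\<^sub>m n $$ (i, j)"
    by (subst mult_reverse_identity_index[of _ n n]) (auto simp: reverse_identity_mat_def)
qed (simp_all add: reverse_identity_mat_def)

lemma centrosymmetric_index:
  assumes Q: "Q \<in> carrier_mat n n"
    and "reverse_identity_mat n * Q * reverse_identity_mat n = Q"
    and i: "i < n" and j: "j < n"
  shows "Q $$ (n - 1 - i, n - 1 - j) = Q $$ (i, j)"
proof -
  have "Q $$ (i, j) = (reverse_identity_mat n * Q * reverse_identity_mat n) $$ (i, j)"
    using assms by simp
  also have "\<dots> = Q $$ (n - 1 - i, n - 1 - j)"
    using i j Q
    by (simp add: mult_reverse_identity_index[of _ n n] reverse_identity_mult_index[of _ n n]
        mult_carrier_mat[of _ n n])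
  finally show ?thesis by simp
qed

text \<open>Conjugation by \<open>[[1, 1], [J, -J]]\<close> block-diagonalises \<open>Q\<close>.\<close>

lemma char_poly_centrosymmetric:
  fixes Q :: "real mat"
  assumes Q: "Q \<in> carrier_mat (n + n) (n + n)"
    and cent: "\<And>i j. i < n + n \<Longrightarrow> j < n + n \<Longrightarrow>
      Q $$ (n + n - 1 - i, n + n - 1 - j) = Q $$ (i, j)"
  shows "char_poly Q =
      char_poly (mat n n (\<lambda>(i, j). Q $$ (i, j) + Q $$ (i, n + n - 1 - j))) *
      char_poly (mat n n (\<lambda>(i, j). Q $$ (i, j) - Q $$ (i, n + n - 1 - j)))"
proof -
  define J where "J = reverse_identity_mat n"
  define A where "A = mat n n (\<lambda>(i, j). Q $$ (i, j))"
  define G where "G = mat n n (\<lambda>(i, j). Q $$ (i, n + n - 1 - j))"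
  define T where "T = four_block_mat (1\<^sub>m n) (1\<^sub>m n) J (- J)"
  \<comment> \<open>\<open>V\<close> is the transpose of \<open>T\<close>, so \<open>T\<close> is
    sqrt 2 times an orthogonal matrix; keeping the factor 2 avoids the square root.\<close>
  define V where "V = four_block_mat (1\<^sub>m n) J (1\<^sub>m n) (- J)"
  define B where "B = four_block_mat (A + G) (0\<^sub>m n n) (0\<^sub>m n n) (A - G)"
  have J [simp]: "J \<in> carrier_mat n n" and JJ: "J * J = 1\<^sub>m n"
    by (simp_all add: J_def reverse_identity_squared)
  have A [simp]: "A \<in> carrier_mat n n" and G [simp]: "G \<in> carrier_mat n n"
    by (simp_all add: A_def G_def)
  have neg: "- J * - J = 1\<^sub>m n" "X * - J = - (X * J)" "- J * X = - (J * X)"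
    if "X \<in> carrier_mat n n" for X :: "real mat"
    using that J JJ by (auto simp: uminus_mult_left_mat uminus_mult_right_mat simp del: J)
  have [simp]: "dim_row J = n" "dim_col J = n" using J by (auto simp del: J)
  have [simp]: "dim_row A = n" "dim_col A = n" "dim_row G = n" "dim_col G = n"
    by (simp_all add: A_def G_def)
  have TV: "T * V = 2 \<cdot>\<^sub>m 1\<^sub>m (n + n)"
  proof -
    have "T * V = four_block_mat (1\<^sub>m n + 1\<^sub>m n) (J + - J) (J + - J) (1\<^sub>m n + 1\<^sub>m n)"
      unfolding T_def V_def
      by (subst mult_four_block_mat[of _ n n _ n _ n _ _ n _ n]) (simp_all add: JJ neg)
    then show ?thesis by (auto intro!: eq_matI)
  qed
  have VT: "V * T = 2 \<cdot>\<^sub>m 1\<^sub>m (n + n)"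
  proof -
    have "V * T = four_block_mat (1\<^sub>m n + 1\<^sub>m n) (1\<^sub>m n + - 1\<^sub>m n) (1\<^sub>m n + - 1\<^sub>m n) (1\<^sub>m n + 1\<^sub>m n)"
      unfolding T_def V_def
      by (subst mult_four_block_mat[of _ n n _ n _ n _ _ n _ n]) (simp_all add: JJ neg)
    then show ?thesis by (auto intro!: eq_matI)
  qed
  have A_index: "A $$ (i, j) = Q $$ (i, j)" if "i < n" "j < n" for i j
    using that by (simp add: A_def)
  have GJ: "(G * J) $$ (i, k) = Q $$ (i, n + k)" if "i < n" "k < n" for i k
    using that unfolding J_def
    by (subst mult_reverse_identity_index[OF G]) (simp_all add: G_def)
  have JG: "(J * G) $$ (k, j) = Q $$ (n + k, j)" if "k < n" "j < n" for k j
    using that cent[of "n + k" j] unfolding J_def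
    by (subst reverse_identity_mult_index[OF G]) (simp_all add: G_def)
  have JA: "(J * A) $$ (k, j) = Q $$ (n - 1 - k, j)" if "k < n" "j < n" for k j
    using that unfolding J_def
    by (subst reverse_identity_mult_index[OF A]) (simp_all add: A_def)
  have JAJ: "(J * A * J) $$ (k, l) = Q $$ (n + k, n + l)" if "k < n" "l < n" for k l
  proof -
    have "(J * A * J) $$ (k, l) = (J * A) $$ (k, n - 1 - l)"
      using that mult_reverse_identity_index[of "J * A" n n k l]
      by (simp add: J_def mult_carrier_mat[of _ n n _ n])
    then show ?thesis using that JA[of k "n - 1 - l"] cent[of "n + k" "n + l"] by simp
  qed
  \<comment> \<open>\<open>G\<close> is the upper right block with its columns reversed, so the
    upper blocks are immediate; \<open>cent\<close> enters only in the lower ones.\<close>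
  have Q_block: "Q = four_block_mat A (G * J) (J * G) (J * A * J)"
  proof (rule eq_matI)
    fix i j assume "i < dim_row (four_block_mat A (G * J) (J * G) (J * A * J))"
      and "j < dim_col (four_block_mat A (G * J) (J * G) (J * A * J))"
    then have "i < n + n" "j < n + n" by simp_all
    then show "Q $$ (i, j) = four_block_mat A (G * J) (J * G) (J * A * J) $$ (i, j)"
      by (auto simp: GJ JG JAJ A_index simp del: index_mult_mat(1))
  qed (use Q in simp_all)
  have GJJ: "G * J * J = G" and AJJ: "J * A * J * J = J * A"
    by (simp_all add: assoc_mult_mat[of _ n n _ n _ n] mult_carrier_mat[of _ n n _ n] JJ)
  have QT: "Q * T = four_block_mat (A + G) (A + - G) (J * G + J * A) (J * G + - (J * A))"
    unfolding Q_block T_def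
    by (subst mult_four_block_mat[of _ n n _ n _ n _ _ n _ n])
      (simp_all add: GJJ AJJ mult_carrier_mat[of _ n n _ n] uminus_mult_right_mat)
  have TB: "T * B = four_block_mat (A + G) (A - G) (J * (A + G)) (- (J * (A - G)))"
    unfolding B_def T_def
    by (subst mult_four_block_mat[of _ n n _ n _ n _ _ n _ n])
      (simp_all add: mult_carrier_mat[of _ n n _ n] uminus_mult_left_mat minus_carrier_mat
        left_add_zero_mat[of _ n n])
  have "Q * T = T * B"
    unfolding QT TB comm_add_mat[OF mult_carrier_mat[OF J G] mult_carrier_mat[OF J A]]
    by (simp add: mult_add_distrib_mat[of _ n n _ n] minus_add_uminus_mat[of _ n n]
        uminus_mult_right_mat uminus_add_mat[of _ n n] mult_carrier_mat[of _ n n _ n])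
  have T: "T \<in> carrier_mat (n + n) (n + n)" and V: "V \<in> carrier_mat (n + n) (n + n)"
    and B: "B \<in> carrier_mat (n + n) (n + n)"
    by (simp_all add: T_def V_def B_def minus_carrier_mat)
  have "T * B * ((1/2) \<cdot>\<^sub>m V) = Q * (T * ((1/2) \<cdot>\<^sub>m V))"
    unfolding \<open>Q * T = T * B\<close>[symmetric] by (rule assoc_mult_mat[OF Q T smult_carrier_mat[OF V]])
  also have "T * ((1/2) \<cdot>\<^sub>m V) = 1\<^sub>m (n + n)"
    unfolding mult_smult_distrib[OF T V] TV by (auto intro!: eq_matI)
  finally have Q_conj: "Q = T * B * ((1/2) \<cdot>\<^sub>m V)" using Q by simp
  have "similar_mat Q B"
  proof (rule similar_matI[OF _ _ _ Q_conj])
    show "T * ((1/2) \<cdot>\<^sub>m V) = 1\<^sub>m (n + n)"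
      unfolding mult_smult_distrib[OF T V] TV by (auto intro!: eq_matI)
    show "(1/2) \<cdot>\<^sub>m V * T = 1\<^sub>m (n + n)"
      unfolding mult_smult_assoc_mat[OF V T] VT by (auto intro!: eq_matI)
  qed (use Q T V B in simp)
  then have "char_poly Q = char_poly B" by (rule char_poly_similar)
  also have "\<dots> = char_poly (A + G) * char_poly (A - G)"
    unfolding B_def by (rule char_poly_block_diag) auto
  also have "A + G = mat n n (\<lambda>(i, j). Q $$ (i, j) + Q $$ (i, n + n - 1 - j))"
    by (auto simp: A_def G_def)
  also have "A - G = mat n n (\<lambda>(i, j). Q $$ (i, j) - Q $$ (i, n + n - 1 - j))"
    by (auto simp: A_def G_def)
  finally show ?thesis .
qed

section \<open>Splitting a product of linear factors\<close>

text \<open>Unique factorisation becomes a finite enumeration: equal entries count as separate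
  choices, which only repeats cases.\<close>

fun splits :: "'a list \<Rightarrow> ('a list \<times> 'a list) list" where
  "splits [] = [([], [])]"
| "splits (x # xs) =
    map (\<lambda>(ys, zs). (x # ys, zs)) (splits xs) @ map (\<lambda>(ys, zs). (ys, x # zs)) (splits xs)"

text \<open>Induction on the linear factors: \<open>x\<close> is a root of \<open>p\<close> or of
  \<open>q\<close>, and cancelling its factor there leaves a monic polynomial.\<close>

lemma monic_mult_eq_prod_list_linear:
  fixes p q :: "'a :: field poly"
  assumes "p * q = (\<Prod>x\<leftarrow>xs. [:- x, 1:])" and "lead_coeff p = 1" and "lead_coeff q = 1"
  shows "\<exists>(ys, zs)\<in>set (splits xs). p = (\<Prod>x\<leftarrow>ys. [:- x, 1:]) \<and> q = (\<Prod>x\<leftarrow>zs. [:- x, 1:])"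
  using assms
proof (induction xs arbitrary: p q)
  case Nil
  then have "p * q = 1" by simp
  then have "p dvd 1" by (metis dvd_triv_left)
  then obtain c where c: "p = [:c:]" by (meson is_unit_polyE)
  with Nil.prems(2) have "p = 1" by (simp add: pCons_one)
  with \<open>p * q = 1\<close> show ?case by simp
next
  case (Cons x xs)
  define f where "f = [:- x, 1:]"
  have f: "f \<noteq> 0" "lead_coeff f = 1" by (simp_all add: f_def)
  have prod: "p * q = f * (\<Prod>x\<leftarrow>xs. [:- x, 1:])"
    using Cons.prems(1) by (simp only: f_def list.map prod_list.Cons)
  then have "poly (p * q) x = 0" by (simp add: f_def)
  then have "poly p x = 0 \<or> poly q x = 0" by simp
  then have "f dvd p \<or> f dvd q" by (simp only: f_def poly_eq_0_iff_dvd)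
  then show ?case
  proof (elim disjE dvdE)
    fix r assume r: "p = f * r"
    have "r * q = (\<Prod>x\<leftarrow>xs. [:- x, 1:])" using prod f(1) by (simp add: r mult.assoc)
    moreover have "lead_coeff r = 1" using Cons.prems(2) f(2) by (simp add: r lead_coeff_mult)
    ultimately obtain ys zs where split: "(ys, zs) \<in> set (splits xs)"
        "r = (\<Prod>x\<leftarrow>ys. [:- x, 1:])" "q = (\<Prod>x\<leftarrow>zs. [:- x, 1:])"
      using Cons.IH[OF _ _ Cons.prems(3)] by blast
    then have "(x # ys, zs) \<in> set (splits (x # xs))" by force
    moreover have "p = (\<Prod>x\<leftarrow>x # ys. [:- x, 1:])"
      by (simp only: r split(2) f_def list.map prod_list.Cons)
    ultimately show ?case using split(3) by blast
  next
    fix r assume r: "q = f * r"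
    have "p * r = (\<Prod>x\<leftarrow>xs. [:- x, 1:])" using prod f(1) by (simp add: r mult.left_commute)
    moreover have "lead_coeff r = 1" using Cons.prems(3) f(2) by (simp add: r lead_coeff_mult)
    ultimately obtain ys zs where split: "(ys, zs) \<in> set (splits xs)"
        "p = (\<Prod>x\<leftarrow>ys. [:- x, 1:])" "r = (\<Prod>x\<leftarrow>zs. [:- x, 1:])"
      using Cons.IH[OF _ Cons.prems(2)] by blast
    then have "(ys, x # zs) \<in> set (splits (x # xs))" by force
    moreover have "q = (\<Prod>x\<leftarrow>x # zs. [:- x, 1:])"
      by (simp only: r split(3) f_def list.map prod_list.Cons)
    ultimately show ?case using split(2) by blast
  qed
qed

lemma degree_prod_list_linear:
  "degree (\<Prod>x\<leftarrow>xs. [:- x, 1 :: 'a :: idom:]) = length xs"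
proof (induction xs)
  case (Cons x xs)
  have "(\<Prod>x\<leftarrow>xs. [:- x, 1 :: 'a:]) \<noteq> 0" by (auto simp: prod_list_zero_iff)
  then show ?case using Cons by (simp add: degree_mult_eq del: mult_pCons_left)
qed simp

section \<open>The two cubic factors\<close>

text \<open>
  Here \<open>S\<close> is the symmetric matrix with diagonal \<open>c1, c2, c3\<close>, and \<open>xi\<close> is its entry off row and
  column \<open>i\<close>. The \<open>pi\<close> and \<open>qi\<close> are the entries of the adjugate of \<open>t I - S\<close>; both its trace and the
  trace of its square vanish, so it is zero.
\<close>

lemma double_top_eigenvalue_3:
  fixes c1 c2 c3 x1 x2 x3 t k :: real
  assumes nonneg: "0 \<le> x1" "0 \<le> x2" "0 \<le> x3" and "0 \<le> k" "0 < t"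
    and e1: "c1 + c2 + c3 = 2 * t - k"
    and e2: "c1 * c2 + c1 * c3 + c2 * c3 - x1^2 - x2^2 - x3^2 = t^2 - 2 * t * k"
    and e3: "c1 * c2 * c3 + 2 * x1 * x2 * x3 - c1 * x1^2 - c2 * x2^2 - c3 * x3^2 = - k * t^2"
  shows "c1 = t \<and> x2 = 0 \<and> x3 = 0 \<or> c2 = t \<and> x1 = 0 \<and> x3 = 0 \<or> c3 = t \<and> x1 = 0 \<and> x2 = 0"
proof -
  \<comment> \<open>The hypotheses say that S has eigenvalues t, t, -k. The \<open>mi\<close> are
    the diagonal of t I - S, whose trace is t + k > 0.\<close>
  define m1 m2 m3 where m: "m1 = t - c1" "m2 = t - c2" "m3 = t - c3"
  have c: "c1 = t - m1" "c2 = t - m2" "c3 = t - m3" using m by simp_all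
  define p1 p2 p3 where p: "p1 = m2 * m3 - x1^2" "p2 = m1 * m3 - x2^2" "p3 = m1 * m2 - x3^2"
  define q1 q2 q3 where q: "q1 = x2 * x3 + m1 * x1" "q2 = x1 * x3 + m2 * x2" "q3 = x1 * x2 + m3 * x3"
  have tr: "k = m1 + m2 + m3 - t" using e1 m by simp
  have p_sum: "p1 + p2 + p3 = 0"
    using e2 unfolding c p tr by (simp add: algebra_simps power2_eq_square)
  \<comment> \<open>This is det (t I - S), evaluated next as the characteristic polynomial of S at
    its root t.\<close>
  define d where "d = m1 * m2 * m3 - 2 * x1 * x2 * x3 - m1 * x1^2 - m2 * x2^2 - m3 * x3^2"
  have "d = t^3 - t^2 * (c1 + c2 + c3) + t * (c1 * c2 + c1 * c3 + c2 * c3 - x1^2 - x2^2 - x3^2)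
      - (c1 * c2 * c3 + 2 * x1 * x2 * x3 - c1 * x1^2 - c2 * x2^2 - c3 * x3^2)"
    unfolding d_def m by (simp add: algebra_simps power2_eq_square power3_eq_cube)
  also have "\<dots> = 0"
    unfolding e1 e2 e3 by (simp add: algebra_simps power2_eq_square power3_eq_cube)
  finally have d0: "d = 0" .
  \<comment> \<open>Jacobi's identity: a 2 by 2 principal minor of the adjugate is the determinant
    times the complementary entry.\<close>
  have "p1 * p2 - q3^2 = m3 * d" "p1 * p3 - q2^2 = m2 * d" "p2 * p3 - q1^2 = m1 * d"
    unfolding p q d_def by (simp_all add: algebra_simps power2_eq_square)
  with d0 have pp: "p1 * p2 = q3^2" "p1 * p3 = q2^2" "p2 * p3 = q1^2" by simp_all
  have "p1^2 + p2^2 + p3^2 + 2 * (q1^2 + q2^2 + q3^2) = (p1 + p2 + p3)^2"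
    unfolding pp[symmetric] by (simp add: algebra_simps power2_eq_square)
  then have "p1^2 + p2^2 + p3^2 + 2 * (q1^2 + q2^2 + q3^2) = 0" using p_sum by simp
  then have p0: "p1 = 0" "p2 = 0" "p3 = 0" and q0: "q1 = 0" "q2 = 0" "q3 = 0"
    by (simp_all add: add_nonneg_eq_0_iff)
  have mm: "m1 * m2 = x3^2" "m1 * m3 = x2^2" "m2 * m3 = x1^2"
    using p p0 by simp_all
  \<comment> \<open>By \<open>mm\<close> each product is a sum of three squares.\<close>
  have "0 \<le> m1 * (m1 + m2 + m3)" "0 \<le> m2 * (m1 + m2 + m3)" "0 \<le> m3 * (m1 + m2 + m3)"
    using mm by (simp_all add: distrib_left mult.commute)
  moreover have "0 < m1 + m2 + m3" using tr \<open>0 \<le> k\<close> \<open>0 < t\<close> by simp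
  ultimately have m_nonneg: "0 \<le> m1" "0 \<le> m2" "0 \<le> m3"
    by (simp_all add: zero_le_mult_iff)
  \<comment> \<open>Each \<open>qi\<close> is a sum of two nonnegative terms. So at most one
    \<open>xi\<close> is nonzero, and then \<open>mi\<close> = 0; if all \<open>xi\<close> vanish,
    \<open>mm\<close> makes two of the \<open>mi\<close> vanish.\<close>
  have "x2 * x3 = 0 \<and> m1 * x1 = 0" "x1 * x3 = 0 \<and> m2 * x2 = 0" "x1 * x2 = 0 \<and> m3 * x3 = 0"
    using q q0 nonneg m_nonneg by (simp_all add: add_nonneg_eq_0_iff)
  then show ?thesis
    using mm by (auto simp: c)
qed

text \<open>The tuples belong, in order, to \<open>ys\<close> = (8, -1, -7), (8, -4, -4), (8, -1,
  -4), (8, 8, -1), (8, 8, -4), (8, 8, -7) up to order: these are the triples with nonnegative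
  sum.\<close>

lemma split_elementary_symmetric:
  fixes e1 e2 e3 f1 f2 f3 :: real
  assumes split: "(ys, zs) \<in> set (splits [8, -1, -7, 8, -4, -4])"
    and ys: "[:- e3, e2, - e1, 1:] = (\<Prod>x\<leftarrow>ys. [:- x, 1:])"
    and zs: "[:- f3, f2, - f1, 1:] = (\<Prod>x\<leftarrow>zs. [:- x, 1:])"
  shows "e1 + f1 = 0 \<and> (0 \<le> e1 \<longrightarrow> (e1, e2, e3, f2, f3) \<in>
      {(0, -57, 56, -48, 128), (0, -48, 128, -57, 56), (3, -36, 32, -60, 224),
       (15, 48, -64, 72, -112), (12, 0, -256, 39, -28), (9, -48, -448, 24, -16)})"
proof -
  have "length ys = 3"
    using arg_cong[OF ys, of degree] by (simp add: degree_prod_list_linear)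
  with split have "(ys, zs) \<in> set (filter (\<lambda>(ys, zs). length ys = 3) (splits [8, -1, -7, 8, -4, -4]))"
    by (simp del: splits.simps)
  then show ?thesis by simp (elim disjE; use ys zs in simp)
qed

text \<open>The cubics are the characteristic polynomials of S, with diagonal \<open>ai + ci\<close>
  and off-diagonal entries \<open>xi\<close>, and of D, with diagonal \<open>ai - ci\<close> and
  off-diagonal entries \<open>yi\<close>.\<close>

lemma no_3_3_splitting:
  fixes a1 a2 a3 c1 c2 c3 x1 x2 x3 y1 y2 y3 :: real
  assumes a: "0 \<le> a1" "0 \<le> a2" "0 \<le> a3" and c: "0 \<le> c1" "0 \<le> c2" "0 \<le> c3"
    and xy: "\<bar>y1\<bar> \<le> x1" "\<bar>y2\<bar> \<le> x2" "\<bar>y3\<bar> \<le> x3"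
    and split: "(ys, zs) \<in> set (splits [8, -1, -7, 8, -4, -4])"
    and p: "[:- ((a1 + c1) * (a2 + c2) * (a3 + c3) + 2 * x1 * x2 * x3
        - (a1 + c1) * x1^2 - (a2 + c2) * x2^2 - (a3 + c3) * x3^2),
      (a1 + c1) * (a2 + c2) + (a1 + c1) * (a3 + c3) + (a2 + c2) * (a3 + c3) - x1^2 - x2^2 - x3^2,
      - ((a1 + c1) + (a2 + c2) + (a3 + c3)), 1:] = (\<Prod>x\<leftarrow>ys. [:- x, 1:])"
    and q: "[:- ((a1 - c1) * (a2 - c2) * (a3 - c3) + 2 * y1 * y2 * y3
        - (a1 - c1) * y1^2 - (a2 - c2) * y2^2 - (a3 - c3) * y3^2),
      (a1 - c1) * (a2 - c2) + (a1 - c1) * (a3 - c3) + (a2 - c2) * (a3 - c3) - y1^2 - y2^2 - y3^2,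
      - ((a1 - c1) + (a2 - c2) + (a3 - c3)), 1:] = (\<Prod>x\<leftarrow>zs. [:- x, 1:])"
  shows False
proof -
  \<comment> \<open>The two traces add up to twice this sum.\<close>
  have "a1 + a2 + a3 = 0" using split_elementary_symmetric[OF split p q] by simp
  with a have a0: "a1 = 0" "a2 = 0" "a3 = 0" by linarith+
  define e1 e2 e3 f2 f3 where "e1 = c1 + c2 + c3"
    and "e2 = c1 * c2 + c1 * c3 + c2 * c3 - x1^2 - x2^2 - x3^2"
    and "e3 = c1 * c2 * c3 + 2 * x1 * x2 * x3 - c1 * x1^2 - c2 * x2^2 - c3 * x3^2"
    and "f2 = c1 * c2 + c1 * c3 + c2 * c3 - y1^2 - y2^2 - y3^2"
    and "f3 = 2 * y1 * y2 * y3 - c1 * c2 * c3 + c1 * y1^2 + c2 * y2^2 + c3 * y3^2"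
  note defs = this
  have x: "0 \<le> x1" "0 \<le> x2" "0 \<le> x3" using xy by linarith+
  have vals: "(e1, e2, e3, f2, f3) \<in>
      {(0, -57, 56, -48, 128), (0, -48, 128, -57, 56), (3, -36, 32, -60, 224),
       (15, 48, -64, 72, -112), (12, 0, -256, 39, -28), (9, -48, -448, 24, -16)}"
    using split_elementary_symmetric[OF split p q] c by (simp add: a0 defs algebra_simps)
  \<comment> \<open>The diagonals are now c and -c, so \<open>e2\<close> and \<open>f2\<close>
    differ only in these squares.\<close>
  have "y1^2 \<le> x1^2" "y2^2 \<le> x2^2" "y3^2 \<le> x3^2"
    using xy by (simp_all add: abs_le_square_iff[symmetric] x)
  then have f2_ge: "e2 \<le> f2" by (simp add: defs)
  have e3_ge: "f3 \<le> e3" if "e1 = 0"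
  proof -
    have "c1 = 0" "c2 = 0" "c3 = 0" using that c unfolding defs by linarith+
    moreover have "y1 * y2 * y3 \<le> x1 * x2 * x3"
    proof -
      have "y1 * y2 * y3 \<le> \<bar>y1\<bar> * \<bar>y2\<bar> * \<bar>y3\<bar>" by (metis abs_ge_self abs_mult)
      also have "\<dots> \<le> x1 * x2 * x3" using xy x by (intro mult_mono) auto
      finally show ?thesis .
    qed
    ultimately show ?thesis by (simp add: defs)
  qed
  text \<open>An isolated vertex of weight \<open>8\<close> makes \<open>-8\<close> a root of the second factor.\<close>
  have neg_root: "f3 = - 8 * (f2 - 8 * (e1 - 8))"
    if "e1 = 16 - k" "e2 = 64 - 16 * k" "e3 = - 64 * k" "0 \<le> k" for k
  proof -
    have "c1 = 8 \<and> x2 = 0 \<and> x3 = 0 \<or> c2 = 8 \<and> x1 = 0 \<and> x3 = 0 \<or> c3 = 8 \<and> x1 = 0 \<and> x2 = 0"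
      by (rule double_top_eigenvalue_3[OF x \<open>0 \<le> k\<close>]) (use that in \<open>simp_all add: defs\<close>)
    \<comment> \<open>The bounds \<open>xy\<close> carry the isolation over to D. Its other 2 by 2
      block has trace \<open>- (e1 - 8)\<close>, hence determinant
      \<open>f2 - 8 * (e1 - 8)\<close>.\<close>
    then have "c1 = 8 \<and> y2 = 0 \<and> y3 = 0 \<or> c2 = 8 \<and> y1 = 0 \<and> y3 = 0 \<or> c3 = 8 \<and> y1 = 0 \<and> y2 = 0"
      using xy by fastforce
    then show ?thesis by (auto simp: defs algebra_simps)
  qed
  \<comment> \<open>The second case covers \<open>ys\<close> = (8, -4, -4) and (8, -1, -4). In the
    last three, \<open>neg_root\<close> would require \<open>f3\<close> = -128, -56, -128
    respectively.\<close>
  from vals consider "e1 = 0" "e3 < f3" | "f2 < e2"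
    | "e1 = 16 - 1" "e2 = 64 - 16 * 1" "e3 = - 64 * 1" "f2 = 72" "f3 = - 112"
    | "e1 = 16 - 4" "e2 = 64 - 16 * 4" "e3 = - 64 * 4" "f2 = 39" "f3 = - 28"
    | "e1 = 16 - 7" "e2 = 64 - 16 * 7" "e3 = - 64 * 7" "f2 = 24" "f3 = - 16"
    by auto
  then show False
    by cases (use f2_ge e3_ge neg_root[of 1] neg_root[of 4] neg_root[of 7] in auto)
qed

section \<open>The list 8, -1, -7, 8, -4, -4\<close>

lemma SNIEP_witness: "[8, -1, -7, 8, -4, -4] \<in> SNIEP 6"
proof -
  \<comment> \<open>(1, -1, 0) has eigenvalue -7; on vectors (u, u, v) the matrix acts as [[7, 2],
    [4, 0]], with eigenvalues 8 and -1. \<open>B\<close> is 4 times the adjacency matrix of a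
    triangle.\<close>
  define A :: "real mat" where "A = mat 3 3 (\<lambda>(i, j). if i = j then 0 else if i < 2 \<and> j < 2 then 7 else 2)"
  define B :: "real mat" where "B = mat 3 3 (\<lambda>(i, j). if i = j then 0 else 4)"
  define Q where "Q = four_block_mat A (0\<^sub>m 3 3) (0\<^sub>m 3 3) B"
  have A: "A \<in> carrier_mat 3 3" and B: "B \<in> carrier_mat 3 3"
    by (simp_all add: A_def B_def)
  have Q: "Q \<in> carrier_mat 6 6"
    using four_block_carrier_mat[OF A B] by (simp add: Q_def)
  have "char_poly A = [:- 56, - 57, 0, 1:]"
    by (subst char_poly_symmetric_3[OF A]) (simp_all add: A_def)
  moreover have "char_poly B = [:- 128, - 48, 0, 1:]"
    by (subst char_poly_symmetric_3[OF B]) (simp_all add: B_def)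
  ultimately have spec: "has_spectrum_list Q [8, -1, -7, 8, -4, -4]"
    unfolding has_spectrum_list_def Q_def char_poly_block_diag[OF A B] by simp
  have "transpose_mat A = A" "transpose_mat B = B"
    by (auto simp: A_def B_def)
  then have "symmetric_mat Q"
    using A B by (simp add: symmetric_mat_def Q_def transpose_four_block_mat[of _ 3 3 _ 3 _ 3])
  moreover have "nonneg_mat Q"
    using A B by (auto simp: nonneg_mat_def less_eq_mat_def Q_def) (auto simp: A_def B_def)
  ultimately show ?thesis using Q spec by (auto simp: SNIEP_def)
qed

lemma BNIEP_witness: "[8, -1, -7, 8, -4, -4] \<notin> BNIEP 6"
proof
  assume "[8, -1, -7, 8, -4, -4] \<in> BNIEP 6"
  then obtain Q where Q: "Q \<in> carrier_mat 6 6" and "bisymmetric_mat Q" and "nonneg_mat Q"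
    and spec: "char_poly Q = (\<Prod>x\<leftarrow>[8, -1, -7, 8, -4, -4]. [:- x, 1:])"
    by (auto simp: BNIEP_def has_spectrum_list_def)
  then have trans: "transpose_mat Q = Q"
    and cent: "reverse_identity_mat 6 * Q * reverse_identity_mat 6 = Q"
    by (simp_all add: bisymmetric_mat_def symmetric_mat_def)
  have sym: "Q $$ (i, j) = Q $$ (j, i)" if "i < 6" "j < 6" for i j
    using that Q trans by (metis carrier_matD index_transpose_mat(1))
  have cent: "Q $$ (5 - i, 5 - j) = Q $$ (i, j)" if "i < 6" "j < 6" for i j
    using centrosymmetric_index[OF Q cent that] by simp
  have pos: "0 \<le> Q $$ (i, j)" if "i < 6" "j < 6" for i j
    using \<open>nonneg_mat Q\<close> Q that by (simp add: nonneg_mat_def less_eq_mat_def)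
  define S where "S = mat 3 3 (\<lambda>(i, j). Q $$ (i, j) + Q $$ (i, 5 - j))"
  define D where "D = mat 3 3 (\<lambda>(i, j). Q $$ (i, j) - Q $$ (i, 5 - j))"
  have prod: "char_poly Q = char_poly S * char_poly D"
    using char_poly_centrosymmetric[of Q 3] Q cent by (simp add: S_def D_def)
  have S: "S \<in> carrier_mat 3 3" and D: "D \<in> carrier_mat 3 3" by (simp_all add: S_def D_def)
  \<comment> \<open>The second row is the symmetry of the reversed upper right block: transpose,
    then reverse both indices.\<close>
  have Q_sym: "Q $$ (1, 0) = Q $$ (0, 1)" "Q $$ (2, 0) = Q $$ (0, 2)" "Q $$ (2, 1) = Q $$ (1, 2)"
    "Q $$ (1, 5) = Q $$ (0, 4)" "Q $$ (2, 5) = Q $$ (0, 3)" "Q $$ (2, 4) = Q $$ (1, 3)"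
    using sym[of 1 0] sym[of 2 0] sym[of 2 1] sym[of 1 5] sym[of 2 5] sym[of 2 4]
      cent[of 0 4] cent[of 0 3] cent[of 1 3] by simp_all
  have S_entry: "S $$ (i, j) = Q $$ (i, j) + Q $$ (i, 5 - j)"
    and D_entry: "D $$ (i, j) = Q $$ (i, j) - Q $$ (i, 5 - j)" if "i < 3" "j < 3" for i j
    using that by (simp_all add: S_def D_def)
  have "\<exists>(ys, zs)\<in>set (splits [8, -1, -7, 8, -4, -4]).
      char_poly S = (\<Prod>x\<leftarrow>ys. [:- x, 1:]) \<and> char_poly D = (\<Prod>x\<leftarrow>zs. [:- x, 1:])"
    using prod spec degree_monic_char_poly[OF S] degree_monic_char_poly[OF D]
    by (intro monic_mult_eq_prod_list_linear) simp_all
  then obtain ys zs where split: "(ys, zs) \<in> set (splits [8, -1, -7, 8, -4, -4])"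
    and ys: "char_poly S = (\<Prod>x\<leftarrow>ys. [:- x, 1:])" and zs: "char_poly D = (\<Prod>x\<leftarrow>zs. [:- x, 1:])"
    by blast
  have S_sym: "S $$ (1, 0) = S $$ (0, 1)" "S $$ (2, 0) = S $$ (0, 2)" "S $$ (2, 1) = S $$ (1, 2)"
    and D_sym: "D $$ (1, 0) = D $$ (0, 1)" "D $$ (2, 0) = D $$ (0, 2)" "D $$ (2, 1) = D $$ (1, 2)"
    by (simp_all add: S_entry D_entry Q_sym del: One_nat_def)
  have abs: "\<bar>D $$ (i, j)\<bar> \<le> S $$ (i, j)" if "i < 3" "j < 3" for i j
    using that pos[of i j] pos[of i "5 - j"] by (auto simp: S_entry D_entry abs_le_iff)
  show False
  \<comment> \<open>The pairs (1,2), (0,2), (0,1) follow the order of the omitted index;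
    \<open>ai\<close> and \<open>ci\<close> come from the diagonal and antidiagonal of
    \<open>Q\<close>.\<close>
  proof (rule no_3_3_splitting[OF _ _ _ _ _ _ abs[of 1 2] abs[of 0 2] abs[of 0 1] split])
    show "0 \<le> Q $$ (0,0)" "0 \<le> Q $$ (1,1)" "0 \<le> Q $$ (2,2)"
      "0 \<le> Q $$ (0,5)" "0 \<le> Q $$ (1,4)" "0 \<le> Q $$ (2,3)"
      by (simp_all add: pos)
  qed (use ys zs char_poly_symmetric_3[OF S S_sym] char_poly_symmetric_3[OF D D_sym]
      in \<open>simp_all add: S_entry D_entry\<close>)
qed

theorem theorem2p6:
  shows "\<exists>xs :: real list. length xs = 6 \<and> xs \<in> SNIEP 6 \<and> xs \<notin> BNIEP 6"
  using SNIEP_witness BNIEP_witness by (intro exI[of _ "[8, -1, -7, 8, -4, -4]"]) simp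

end
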